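(* Let $H:\mathbb{R}\to\mathbb{R}$ be a smooth, bounded function with $H(-s)=H(s)\ge 0$ for all $s$, $\int_0^{+\infty} sH(s)\,ds=1$, and such that $H$ either has compact support or $H$ and all its derivatives decay sufficiently fast as $|s|\to\infty$. Let $\zeta:\mathbb{R}\to\mathbb{R}$ be uniformly bounded and smooth with bounded derivative on $\mathbb{R}$, with $\min_{x\in\mathbb{R}}\zeta(x)=\delta_m>0$. Define $\gamma(s,x)=\zeta(x)^{-2}H(s/\zeta(x))$ and $k(x)=\int_0^{+\infty}\gamma(s,x)\,ds$. Let $\psi_0$ be continuous and uniformly bounded on $\mathbb{R}$, piecewise smooth, with a piecewise bounded derivative $\psi_{0x}$ having only finitely many jump discontinuities. Let $u=u(x,t)$ be the solution of $$u_t(x,t)+\int_0^{+\infty}\big[u(x,t)-u(x-s,t)\big]\gamma(s,x)\,ds=0,\quad x\in\mathbb{R},\ t>0,\qquad u(x,0)=\psi_0(x).$$ Then for all $t\in\mathbb{R}^+$ and $x\in\mathbb{R}$, $$[u_x](x,t)=e^{-k(x)t}[u_x](x,0)=e^{-k(x)t}[\psi_{0x}](x).$$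
   Context: For a function $f$ of $x$, $[f](x)=f(x^+)-f(x^-)$ denotes the jump of $f$ at $x$ (difference of right and left limits); $[u_x](x,t)$ is the jump in $x$ of the spatial derivative $u_x(\cdot,t)$. The equation is a nonlocal analogue of $u_t+u_x=0$ with an upwind nonlocal derivative and spatially varying horizon $\zeta(x)$; note $k(x)=\zeta(x)^{-1}\int_0^{+\infty}yH(y)\,dy$. *)

theory Defs
  imports "HOL-Analysis.Analysis"
begin

definition smooth_fun :: "(real \<Rightarrow> real) \<Rightarrow> bool" where
  "smooth_fun f \<longleftrightarrow> (\<forall>n x. ((deriv ^^ n) f) differentiable (at x))"

definition gam :: "(real \<Rightarrow> real) \<Rightarrow> (real \<Rightarrow> real) \<Rightarrow> real \<Rightarrow> real \<Rightarrow> real" where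
  "gam H \<zeta> s x = (\<zeta> x) powi (-2) * H (s / \<zeta> x)"

definition kfun :: "(real \<Rightarrow> real) \<Rightarrow> (real \<Rightarrow> real) \<Rightarrow> real \<Rightarrow> real" where
  "kfun H \<zeta> x = integral {0..} (\<lambda>s. gam H \<zeta> s x)"

definition has_jump :: "(real \<Rightarrow> real) \<Rightarrow> real \<Rightarrow> real \<Rightarrow> bool" where
  "has_jump f x J \<longleftrightarrow> (\<exists>l r. (f \<longlongrightarrow> r) (at_right x) \<and> (f \<longlongrightarrow> l) (at_left x) \<and> J = r - l)"

end

theory Submission
  imports Defs "HOL-Probability.Sinc_Integral"
begin

text \<open>
  With \<open>g(x,t) = \<integral>\<^sub>0\<^sup>\<infinity> u(x - s,t) \<gamma>(s,x) ds\<close> the equation reads \<open>u\<^sub>t = - k(x) u + g\<close>, so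
  \<open>u(x,t) = exp (- k(x) t) (\<psi>\<^sub>0(x) + \<integral>\<^sub>0\<^sup>t exp (k(x) \<tau>) g(x,\<tau>) d\<tau>)\<close>. It suffices that \<open>g\<close> is \<open>C\<^sup>1\<close> in \<open>x\<close>,
  with \<open>g\<^sub>x\<close> jointly continuous: the only discontinuous term of \<open>u\<^sub>x\<close> is then \<open>exp (- k t) \<psi>\<^sub>0\<^sub>x\<close>.
  The averaging gains this regularity in two steps. Boundedness of \<open>u\<close> alone makes \<open>g\<close> jointly
  continuous, by dominated convergence in the variable \<open>y = x - s\<close>; hence \<open>u\<close> is jointly continuous.
  If then \<open>W\<close> is an antiderivative of \<open>u(\<cdot>,t)\<close>, integration by parts gives
  \<open>\<zeta>(x)\<^sup>2 g(x,t) = W(x) H(0) + \<integral>\<^sub>0\<^sup>\<infinity> W(x - \<zeta>(x) r) H'(r) dr\<close>,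
  which can be differentiated under the integral sign because \<open>W\<close> is Lipschitz.
\<close>

section \<open>Integrability and limit theorems on the half line\<close>

lemma integrable_on_inverse_1_plus_square:
  "(\<lambda>x::real. inverse (1 + x\<^sup>2)) integrable_on UNIV"
  "(\<lambda>x::real. inverse (1 + x\<^sup>2)) integrable_on {0..}"
proof -
  have "set_integrable lborel UNIV (\<lambda>x::real. inverse (1 + x\<^sup>2))"
    using integrable_inverse_1_plus_square by (simp add: einterval_eq)
  then show *: "(\<lambda>x::real. inverse (1 + x\<^sup>2)) integrable_on UNIV"
    by (rule set_borel_integral_eq_integral(1))
  have "(\<lambda>x::real. inverse (1 + x\<^sup>2)) absolutely_integrable_on UNIV"
    by (rule nonnegative_absolutely_integrable_1[OF *]) (simp add: add_nonneg_nonneg)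
  then have "(\<lambda>x::real. inverse (1 + x\<^sup>2)) absolutely_integrable_on {0..}"
    by (rule set_integrable_subset) auto
  then show "(\<lambda>x::real. inverse (1 + x\<^sup>2)) integrable_on {0..}"
    by (rule set_lebesgue_integral_eq_integral(1))
qed

text \<open>The weight \<open>inverse (1 + s\<^sup>2)\<close> is the common integrable majorant for
  all kernels below; continuity supplies measurability.\<close>

lemma absolutely_integrable_on_quadratic_decay:
  fixes f :: "real \<Rightarrow> real"
  assumes "continuous_on {0..} f" and "\<And>s. 0 \<le> s \<Longrightarrow> \<bar>f s\<bar> \<le> C * inverse (1 + s\<^sup>2)"
  shows "f absolutely_integrable_on {0..}"
proof (rule measurable_bounded_by_integrable_imp_absolutely_integrable)
  show "f \<in> borel_measurable (lebesgue_on {0..})"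
    by (rule continuous_imp_measurable_on_sets_lebesgue[OF assms(1)]) auto
  show "(\<lambda>s. C * inverse (1 + s\<^sup>2)) integrable_on {0..}"
    by (intro integrable_on_mult_right integrable_on_inverse_1_plus_square)
qed (use assms(2) in auto)

lemma integrable_on_quadratic_decay:
  fixes f :: "real \<Rightarrow> real"
  assumes "continuous_on {0..} f" and "\<And>s. 0 \<le> s \<Longrightarrow> \<bar>f s\<bar> \<le> C * inverse (1 + s\<^sup>2)"
  shows "f integrable_on {0..}"
  using absolutely_integrable_on_quadratic_decay[OF assms] set_lebesgue_integral_eq_integral(1)
  by blast

text \<open>The Lipschitz bound makes \<open>h\<close> a majorant of all difference quotients, so
  dominated convergence along sequences applies on an unbounded domain.\<close>

lemma has_real_derivative_integral_dominated:
  fixes f :: "real \<Rightarrow> real \<Rightarrow> real"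
  assumes int: "\<And>x. f x integrable_on S" and h: "h integrable_on S"
    and lip: "\<And>x y r. r \<in> S \<Longrightarrow> \<bar>f x r - f y r\<bar> \<le> h r * \<bar>x - y\<bar>"
    and der: "\<And>r. r \<in> S \<Longrightarrow> ((\<lambda>x. f x r) has_real_derivative f' r) (at x0)"
  shows "((\<lambda>x. integral S (f x)) has_real_derivative integral S f') (at x0)"
  unfolding has_field_derivative_iff tendsto_at_iff_sequentially
proof (intro allI impI)
  fix X :: "nat \<Rightarrow> real"
  assume X: "\<forall>i. X i \<in> UNIV - {x0}" "X \<longlonglongrightarrow> x0"
  define q where "q n r = (f (X n) r - f x0 r) / (X n - x0)" for n r
  have "(\<lambda>n. integral S (q n)) \<longlonglongrightarrow> integral S f'"
  proof (rule dominated_convergence(2))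
    show "q n integrable_on S" for n
      unfolding q_def by (intro integrable_on_divide integrable_diff int)
    show "norm (q n r) \<le> h r" if "r \<in> S" for n r
      using lip[OF that, of "X n" x0] X(1) by (auto simp: q_def abs_divide divide_le_eq)
    show "(\<lambda>n. q n r) \<longlonglongrightarrow> f' r" if "r \<in> S" for r
      using der[OF that] X
      unfolding has_field_derivative_iff tendsto_at_iff_sequentially q_def comp_def by blast
  qed (fact h)
  moreover have "integral S (q n) = (integral S (f (X n)) - integral S (f x0)) / (X n - x0)" for n
    unfolding q_def by (simp add: integral_diff int)
  ultimately show "((\<lambda>y. (integral S (f y) - integral S (f x0)) / (y - x0)) \<circ> X)
      \<longlonglongrightarrow> integral S f'"
    by (simp add: comp_def)
qed

text \<open>First countability of the parameter space reduces continuity to sequences, where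
  dominated convergence applies. It is used with pairs (x, t) as parameter.\<close>

lemma continuous_on_integral_dominated:
  fixes f :: "'a::{first_countable_topology, t2_space} \<Rightarrow> real \<Rightarrow> real"
  assumes int: "\<And>p. p \<in> U \<Longrightarrow> f p integrable_on S" and h: "h integrable_on S"
    and le: "\<And>p r. p \<in> U \<Longrightarrow> r \<in> S \<Longrightarrow> \<bar>f p r\<bar> \<le> h r"
    and cont: "\<And>r. r \<in> S \<Longrightarrow> continuous_on U (\<lambda>p. f p r)"
  shows "continuous_on U (\<lambda>p. integral S (f p))"
  unfolding continuous_on_sequentially
proof (intro allI ballI impI, elim conjE)
  fix X a assume X: "a \<in> U" "\<forall>n. X n \<in> U" "X \<longlonglongrightarrow> a"
  have "(\<lambda>n. integral S (f (X n))) \<longlonglongrightarrow> integral S (f a)"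
  proof (rule dominated_convergence(2)[OF _ h])
    show "(\<lambda>n. f (X n) r) \<longlonglongrightarrow> f a r" if "r \<in> S" for r
      using cont[OF that] X unfolding continuous_on_sequentially comp_def by blast
  qed (use X int le in auto)
  then show "((\<lambda>p. integral S (f p)) \<circ> X) \<longlonglongrightarrow> integral S (f a)"
    by (simp add: comp_def)
qed

text \<open>The truncations of \<open>f\<close> to [0, n] are dominated by its absolute value, so
  the finite-interval formula passes to the limit.\<close>

lemma integral_FTC_at_top:
  fixes F f :: "real \<Rightarrow> real"
  assumes der: "\<And>x. (F has_real_derivative f x) (at x)"
    and int: "f absolutely_integrable_on {0..}"
    and lim: "(F \<longlongrightarrow> L) at_top"
  shows "integral {0..} f = L - F 0"
proof (rule LIMSEQ_unique)
  define q where "q n r = (if r \<in> {0..real n} then f r else 0)" for n r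
  have hi: "(f has_integral (F (real n) - F 0)) {0..real n}" for n
    by (rule fundamental_theorem_of_calculus)
      (auto intro: has_field_derivative_at_within der
        simp: has_real_derivative_iff_has_vector_derivative[symmetric])
  then have q: "(q n has_integral (F (real n) - F 0)) {0..}" for n
    unfolding q_def by (subst has_integral_restrict) auto
  have "(\<lambda>n. integral {0..} (q n)) \<longlonglongrightarrow> integral {0..} f"
  proof (rule dominated_convergence(2))
    show "q n integrable_on {0..}" for n
      using q by blast
    show "(\<lambda>r. \<bar>f r\<bar>) integrable_on {0..}"
      using int unfolding absolutely_integrable_on_def by simp
    show "(\<lambda>n. q n r) \<longlonglongrightarrow> f r" if "r \<in> {0..}" for r
    proof (rule tendsto_eventually)
      show "\<forall>\<^sub>F n in sequentially. q n r = f r"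
        using eventually_ge_at_top[of "nat \<lceil>r\<rceil>"]
      proof eventually_elim
        case (elim n)
        then have "r \<le> real n" by linarith
        then show ?case using that by (simp add: q_def)
      qed
    qed
  qed (auto simp: q_def)
  then show "(\<lambda>n. F (real n) - F 0) \<longlonglongrightarrow> integral {0..} f"
    using integral_unique[OF q] by simp
  show "(\<lambda>n. F (real n) - F 0) \<longlonglongrightarrow> L - F 0"
    by (intro tendsto_intros filterlim_compose[OF lim] filterlim_real_sequentially)
qed

section \<open>Changes of variables on the half line\<close>

lemma integral_scale_half_line:
  fixes f :: "real \<Rightarrow> real"
  assumes "f absolutely_integrable_on {0..}" and "0 < z"
  shows "integral {0..} f = z * integral {0..} (\<lambda>r. f (z * r))"
proof -
  have img: "(\<lambda>r. z * r) ` {0..} = {0..}"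
  proof (intro equalityI subsetI)
    fix s :: real assume "s \<in> {0..}"
    then show "s \<in> (\<lambda>r. z * r) ` {0..}"
      using \<open>0 < z\<close> by (intro image_eqI[of _ _ "s / z"]) auto
  qed (use \<open>0 < z\<close> in auto)
  have der: "((\<lambda>r. z * r) has_real_derivative z) (at r within {0..})" for r
    by (auto intro!: derivative_eq_intros)
  have inj: "inj_on (\<lambda>r. z * r) {0..}"
    using \<open>0 < z\<close> by (intro inj_onI) simp
  have "integral {0..} (\<lambda>r. \<bar>z\<bar> * f (z * r)) = integral {0..} f"
    using has_absolute_integral_change_of_variables_1'
        [of "{0..}" "\<lambda>r. z * r" "\<lambda>_. z" f "integral {0..} f"] assms der inj
    unfolding img by auto
  then show ?thesis
    using \<open>0 < z\<close> by simp
qed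

text \<open>The substitution y = x - s moves the dependence on x from the unknown function into the
  kernel and the upper limit.\<close>

lemma integral_reflect_half_line:
  fixes f :: "real \<Rightarrow> real"
  assumes "(\<lambda>s. f (x - s)) absolutely_integrable_on {0..}"
  shows "f absolutely_integrable_on {..x}" "integral {..x} f = integral {0..} (\<lambda>s. f (x - s))"
proof -
  have img: "(\<lambda>s. x - s) ` {0..} = {..x}"
  proof (intro equalityI subsetI)
    fix s :: real assume "s \<in> {..x}"
    then show "s \<in> (\<lambda>s. x - s) ` {0..}"
      by (intro image_eqI[of _ _ "x - s"]) auto
  qed auto
  have der: "((\<lambda>s. x - s) has_real_derivative -1) (at s within {0..})" for s
    by (auto intro!: derivative_eq_intros)
  have "f absolutely_integrable_on {..x} \<and> integral {..x} f = integral {0..} (\<lambda>s. f (x - s))"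
    using has_absolute_integral_change_of_variables_1'
        [of "{0..}" "\<lambda>s. x - s" "\<lambda>_. -1" f "integral {0..} (\<lambda>s. f (x - s))"] assms der
    unfolding img by (auto intro!: inj_onI)
  then show "f absolutely_integrable_on {..x}" "integral {..x} f = integral {0..} (\<lambda>s. f (x - s))"
    by auto
qed

lemma continuous_antiderivative:
  fixes f :: "real \<Rightarrow> real"
  assumes "continuous_on UNIV f"
  shows "\<exists>F. \<forall>x. (F has_real_derivative f x) (at x)"
proof -
  have "isCont f x" for x
    using assms continuous_on_eq_continuous_at by blast
  then show ?thesis
    using einterval_antiderivative[of "-\<infinity>" "\<infinity>" f]
    by (auto simp: has_real_derivative_iff_has_vector_derivative)
qed

section \<open>Joint continuity of nonlocal integrals\<close>

lemma continuous_on_compose_pair: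
  assumes "continuous_on (UNIV \<times> I) (\<lambda>(x, t). w x t)"
    and "continuous_on A f" "continuous_on A g" "g ` A \<subseteq> I"
  shows "continuous_on A (\<lambda>p. w (f p) (g p))"
  using continuous_on_compose2[OF assms(1), of A "\<lambda>p. (f p, g p)"] assms(2-4)
  by (auto intro: continuous_intros)

text \<open>No regularity of \<open>w\<close> in its first argument is needed: in the variable \<open>y = x - s\<close> the integrand
  converges pointwise except at the negligible point \<open>y = x\<close>.\<close>

lemma continuous_on_nonlocal_integral:
  fixes w \<Phi> :: "real \<Rightarrow> real \<Rightarrow> real"
  assumes \<Phi>_cont: "\<And>s. continuous_on UNIV (\<lambda>x. \<Phi> (x - s) x)"
    and \<Phi>_le: "\<And>s x. 0 \<le> s \<Longrightarrow> \<bar>\<Phi> s x\<bar> \<le> C * inverse (1 + s\<^sup>2)"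
    and w_cont: "\<And>y. continuous_on I (w y)"
    and w_le: "\<And>y t. t \<in> I \<Longrightarrow> \<bar>w y t\<bar> \<le> B"
    and int: "\<And>x t. t \<in> I \<Longrightarrow> (\<lambda>s. w (x - s) t * \<Phi> s x) integrable_on {0..}"
  shows "continuous_on (UNIV \<times> I) (\<lambda>(x, t). integral {0..} (\<lambda>s. w (x - s) t * \<Phi> s x))"
  unfolding continuous_on_sequentially
proof (intro allI ballI impI, elim conjE)
  fix P :: "nat \<Rightarrow> real \<times> real" and a
  assume a: "a \<in> UNIV \<times> I" and P: "\<forall>n. P n \<in> UNIV \<times> I" "P \<longlonglongrightarrow> a"
  \<comment> \<open>Extension by zero beyond the upper limit puts all integrals on one domain, while
    \<open>w\<close> is always evaluated at the same \<open>y\<close>.\<close>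
  define q where "q p y = (if y \<in> {..fst p} then w y (snd p) * \<Phi> (fst p - y) (fst p) else 0)"
    for p :: "real \<times> real" and y
  let ?G = "\<lambda>(x, t). integral {0..} (\<lambda>s. w (x - s) t * \<Phi> s x)"
  have B: "0 \<le> B"
    using w_le[of "snd a" 0] a by force
  have C: "0 \<le> C"
    using \<Phi>_le[of 0 0] by simp
  \<comment> \<open>Deleting \<open>fst a\<close> discards the one point where the cut-off of
    \<open>q (P n)\<close> may keep switching as n grows.\<close>
  have q: "(q p has_integral ?G p) (UNIV - {fst a})" if p: "p \<in> UNIV \<times> I" for p
  proof -
    obtain x t where [simp]: "p = (x, t)" and t: "t \<in> I"
      using p by auto
    \<comment> \<open>Reflection requires absolute integrability; the decay of \<open>\<Phi>\<close>
      upgrades the assumed integrability.\<close>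
    have "(\<lambda>s. w (x - s) t * \<Phi> s x) absolutely_integrable_on {0..}"
    proof (rule absolutely_integrable_integrable_bound[OF _ int[OF t]])
      show "(\<lambda>s. B * (C * inverse (1 + s\<^sup>2))) integrable_on {0..}"
        by (intro integrable_on_mult_right integrable_on_inverse_1_plus_square)
      show "norm (w (x - s) t * \<Phi> s x) \<le> B * (C * inverse (1 + s\<^sup>2))" if "s \<in> {0..}" for s
        using that B \<Phi>_le[of s x] w_le[OF t, of "x - s"]
        by (auto simp: abs_mult intro!: mult_mono)
    qed
    then have "(\<lambda>y. w y t * \<Phi> (x - y) x) absolutely_integrable_on {..x}"
      "integral {..x} (\<lambda>y. w y t * \<Phi> (x - y) x) = ?G p"
      using integral_reflect_half_line[of "\<lambda>y. w y t * \<Phi> (x - y) x" x] by auto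
    then have "((\<lambda>y. w y t * \<Phi> (x - y) x) has_integral ?G p) {..x}"
      by (metis set_lebesgue_integral_eq_integral(1) integrable_integral)
    then have "(q p has_integral ?G p) UNIV"
      unfolding q_def by (subst has_integral_restrict_UNIV) simp
    then show ?thesis
      by (rule has_integral_spike_set_eq[THEN iffD1, rotated 2])
        (auto intro: negligible_subset[of "{fst a}"])
  qed
  obtain M where M: "\<And>n. \<bar>fst (P n)\<bar> \<le> M"
  proof -
    have "Bseq (\<lambda>n. fst (P n))"
      using tendsto_fst[OF P(2)] by (intro convergent_imp_Bseq convergentI)
    then show ?thesis
      using that unfolding Bseq_def by (auto)
  qed
  \<comment> \<open>The abscissas of the convergent sequence are bounded by M, so weights centred at
    them share one majorant centred at 0.\<close>
  have shift: "inverse (1 + (x - y)\<^sup>2) \<le> (2 + 2 * M\<^sup>2) * inverse (1 + y\<^sup>2)"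
    if "\<bar>x\<bar> \<le> M" for x y :: real
  proof -
    have x2: "x\<^sup>2 \<le> M\<^sup>2"
      using power_mono[OF that, of 2] by simp
    \<comment> \<open>This square is exactly the difference of the two sides of the next
      inequality.\<close>
    have "0 \<le> (y - 2 * x)\<^sup>2"
      by simp
    then have "y\<^sup>2 \<le> 2 * (x - y)\<^sup>2 + 2 * x\<^sup>2"
      by (simp add: power2_eq_square algebra_simps)
    moreover have "0 \<le> M\<^sup>2 * (x - y)\<^sup>2"
      by simp
    ultimately have "1 + y\<^sup>2 \<le> (2 + 2 * M\<^sup>2) * (1 + (x - y)\<^sup>2)"
      using x2 unfolding distrib_left distrib_right by linarith
    moreover have "0 < 1 + y\<^sup>2" "0 < 1 + (x - y)\<^sup>2"
      by (simp_all add: add_pos_nonneg)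
    ultimately show ?thesis
      by (simp add: field_simps)
  qed
  have "(\<lambda>n. integral (UNIV - {fst a}) (q (P n))) \<longlonglongrightarrow> integral (UNIV - {fst a}) (q a)"
  proof (rule dominated_convergence(2))
    show "q (P n) integrable_on UNIV - {fst a}" for n
      using q P(1) by blast
    have "(\<lambda>y. B * (C * ((2 + 2 * M\<^sup>2) * inverse (1 + y\<^sup>2)))) integrable_on UNIV"
      by (intro integrable_on_mult_right integrable_on_inverse_1_plus_square)
    then show "(\<lambda>y. B * (C * ((2 + 2 * M\<^sup>2) * inverse (1 + y\<^sup>2)))) integrable_on UNIV - {fst a}"
      by (rule integrable_spike_set) (auto intro: negligible_subset[of "{fst a}"])
    show "norm (q (P n) y) \<le> B * (C * ((2 + 2 * M\<^sup>2) * inverse (1 + y\<^sup>2)))" for n y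
    proof (cases "y \<le> fst (P n)")
      case True
      have "\<bar>\<Phi> (fst (P n) - y) (fst (P n))\<bar> \<le> C * inverse (1 + (fst (P n) - y)\<^sup>2)"
        using True by (intro \<Phi>_le) simp
      also have "\<dots> \<le> C * ((2 + 2 * M\<^sup>2) * inverse (1 + y\<^sup>2))"
        using C shift[OF M] by (intro mult_left_mono) auto
      finally have "\<bar>w y (snd (P n))\<bar> * \<bar>\<Phi> (fst (P n) - y) (fst (P n))\<bar>
          \<le> B * (C * ((2 + 2 * M\<^sup>2) * inverse (1 + y\<^sup>2)))"
        using w_le[of "snd (P n)" y] P(1) B by (intro mult_mono) (auto simp: mem_Times_iff)
      then show ?thesis
        using True by (simp add: q_def abs_mult)
    qed (use B C in \<open>auto simp: q_def intro!: mult_nonneg_nonneg add_nonneg_nonneg\<close>)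
    show "(\<lambda>n. q (P n) y) \<longlonglongrightarrow> q a y" if "y \<in> UNIV - {fst a}" for y
    proof -
      have fst: "(\<lambda>n. fst (P n)) \<longlonglongrightarrow> fst a" and snd: "(\<lambda>n. snd (P n)) \<longlonglongrightarrow> snd a"
        using P(2) by (auto intro: tendsto_intros)
      have "y \<noteq> fst a"
        using that by simp
      \<comment> \<open>Left of the limit abscissa the cut-off is eventually inactive; right of it
        \<open>q\<close> is eventually zero.\<close>
      then consider "y < fst a" | "fst a < y"
        by linarith
      then show ?thesis
      proof cases
        case 1
        have "(\<lambda>n. w y (snd (P n))) \<longlonglongrightarrow> w y (snd a)"
          using w_cont[of y] snd P(1) a
          by (auto simp: continuous_on_sequentially comp_def mem_Times_iff)
        moreover have "(\<lambda>n. \<Phi> (fst (P n) - y) (fst (P n))) \<longlonglongrightarrow> \<Phi> (fst a - y) (fst a)"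
          using \<Phi>_cont[of y] fst by (auto simp: continuous_on_sequentially comp_def)
        ultimately have "(\<lambda>n. w y (snd (P n)) * \<Phi> (fst (P n) - y) (fst (P n)))
            \<longlonglongrightarrow> w y (snd a) * \<Phi> (fst a - y) (fst a)"
          by (rule tendsto_mult)
        moreover have "\<forall>\<^sub>F n in sequentially.
            w y (snd (P n)) * \<Phi> (fst (P n) - y) (fst (P n)) = q (P n) y"
          using order_tendstoD(1)[OF fst 1] by eventually_elim (simp add: q_def)
        ultimately show ?thesis
          using 1 by (auto simp: q_def[of a] intro: Lim_transform_eventually)
      next
        case 2
        have "\<forall>\<^sub>F n in sequentially. q (P n) y = q a y"
          using order_tendstoD(2)[OF fst 2] by eventually_elim (use 2 in \<open>simp add: q_def\<close>)
        then show ?thesis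
          by (rule tendsto_eventually)
      qed
    qed
  qed
  moreover have "integral (UNIV - {fst a}) (q (P n)) = ?G (P n)" for n
    by (rule integral_unique[OF q]) (use P(1) in blast)
  moreover have "integral (UNIV - {fst a}) (q a) = ?G a"
    by (rule integral_unique[OF q[OF a]])
  ultimately show "(?G \<circ> P) \<longlonglongrightarrow> ?G a"
    by (simp add: comp_def)
qed

section \<open>The rescaled kernel\<close>

text \<open>The factor \<open>1 + s\<close> in the bound on \<open>H'\<close> pays for the linear
  growth of an antiderivative of the solution, and for the factor r that appears when
  \<open>\<zeta> x * r\<close> is differentiated in x.\<close>

locale upwind_kernel =
  fixes H H' \<zeta> \<zeta>' :: "real \<Rightarrow> real" and \<delta> Z M C :: real
  assumes H_deriv: "\<And>s. (H has_real_derivative H' s) (at s)"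
    and H'_cont: "continuous_on UNIV H'"
    and H_decay: "\<And>s. 0 \<le> s \<Longrightarrow> \<bar>H s\<bar> \<le> C * inverse (1 + s\<^sup>2)"
    and H'_decay: "\<And>s. 0 \<le> s \<Longrightarrow> (1 + s) * \<bar>H' s\<bar> \<le> C * inverse (1 + s\<^sup>2)"
    and \<zeta>_deriv: "\<And>x. (\<zeta> has_real_derivative \<zeta>' x) (at x)"
    and \<zeta>'_cont: "continuous_on UNIV \<zeta>'"
    and \<zeta>'_le: "\<And>x. \<bar>\<zeta>' x\<bar> \<le> M"
    and \<delta>_pos: "0 < \<delta>" and \<zeta>_ge: "\<And>x. \<delta> \<le> \<zeta> x" and \<zeta>_le: "\<And>x. \<zeta> x \<le> Z"
begin

text \<open>This is the retarded part of the upwind operator, which splits as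
  \<open>kfun H \<zeta> x * w x - nonlocal w x\<close>.\<close>

definition nonlocal :: "(real \<Rightarrow> real) \<Rightarrow> real \<Rightarrow> real" where
  "nonlocal w x = integral {0..} (\<lambda>s. w (x - s) * gam H \<zeta> s x)"

text \<open>The derivative of the integrated-by-parts formula, with the antiderivative eliminated:
  the last term comes from the factor \<open>1 / (\<zeta> x)\<^sup>2\<close> and is rewritten
  through \<open>nonlocal w x\<close>.\<close>

definition nonlocal_deriv :: "(real \<Rightarrow> real) \<Rightarrow> real \<Rightarrow> real" where
  "nonlocal_deriv w x =
     (w x * H 0 + integral {0..} (\<lambda>r. w (x - \<zeta> x * r) * ((1 - \<zeta>' x * r) * H' r))) / (\<zeta> x)\<^sup>2
     - 2 * \<zeta>' x / \<zeta> x * nonlocal w x"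

lemma \<zeta>_pos: "0 < \<zeta> x"
  using \<delta>_pos \<zeta>_ge[of x] by linarith

lemma C_nonneg: "0 \<le> C"
  using H_decay[of 0] by simp

lemma M_nonneg: "0 \<le> M"
  using \<zeta>'_le[of 0] by linarith

lemma H_cont: "continuous_on UNIV H"
  using H_deriv DERIV_isCont by (blast intro: continuous_at_imp_continuous_on)

lemma \<zeta>_cont: "continuous_on UNIV \<zeta>"
  using \<zeta>_deriv DERIV_isCont by (blast intro: continuous_at_imp_continuous_on)

lemmas cont [continuous_intros] =
  continuous_on_compose2[OF H_cont _ subset_UNIV] continuous_on_compose2[OF H'_cont _ subset_UNIV]
  continuous_on_compose2[OF \<zeta>_cont _ subset_UNIV] continuous_on_compose2[OF \<zeta>'_cont _ subset_UNIV]

lemma gam_eq: "gam H \<zeta> s x = H (s / \<zeta> x) / (\<zeta> x)\<^sup>2"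
  by (simp add: gam_def power_int_minus divide_inverse)

text \<open>With s = \<zeta>(x) r, the upper bound Z turns decay in r into decay in s, and the lower
  bound \<delta> controls the prefactor; the estimate is uniform in x.\<close>

lemma gam_le:
  assumes "0 \<le> s"
  shows "\<bar>gam H \<zeta> s x\<bar> \<le> (C * (1 + Z\<^sup>2) / \<delta>\<^sup>2) * inverse (1 + s\<^sup>2)"
proof -
  define r where "r = s / \<zeta> x"
  have r: "0 \<le> r" "s = \<zeta> x * r"
    using assms \<zeta>_pos[of x] by (auto simp: r_def)
  have "(\<zeta> x)\<^sup>2 \<le> Z\<^sup>2"
    using \<zeta>_pos[of x] \<zeta>_le[of x] by (intro power_mono) auto
  then have "(\<zeta> x)\<^sup>2 * r\<^sup>2 \<le> Z\<^sup>2 * r\<^sup>2"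
    by (intro mult_right_mono) auto
  then have "1 + s\<^sup>2 \<le> (1 + Z\<^sup>2) * (1 + r\<^sup>2)"
    unfolding r(2) power_mult_distrib distrib_left distrib_right
    using zero_le_power2[of Z] zero_le_power2[of r] by linarith
  moreover have "0 < 1 + s\<^sup>2" "0 < 1 + r\<^sup>2"
    by (simp_all add: add_pos_nonneg)
  ultimately have "inverse (1 + r\<^sup>2) \<le> (1 + Z\<^sup>2) * inverse (1 + s\<^sup>2)"
    by (simp add: field_simps)
  then have "\<bar>H r\<bar> \<le> C * ((1 + Z\<^sup>2) * inverse (1 + s\<^sup>2))"
    using H_decay[OF r(1)] C_nonneg by (meson mult_left_mono order_trans)
  moreover have "\<delta>\<^sup>2 \<le> (\<zeta> x)\<^sup>2"
    using \<delta>_pos \<zeta>_ge[of x] by (intro power_mono) auto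
  ultimately have "\<bar>H r\<bar> / (\<zeta> x)\<^sup>2 \<le> C * ((1 + Z\<^sup>2) * inverse (1 + s\<^sup>2)) / \<delta>\<^sup>2"
    using \<delta>_pos by (intro frac_le) auto
  then show ?thesis
    by (simp add: gam_eq r_def abs_divide)
qed

text \<open>In the second claim \<open>s\<close> stands for the fixed point y = x - s: this is
  continuity in x of the kernel after reflection.\<close>

lemma gam_cont: "continuous_on UNIV (\<lambda>s. gam H \<zeta> s x)" "continuous_on UNIV (\<lambda>x. gam H \<zeta> (x - s) x)"
  unfolding gam_eq using \<zeta>_pos by (auto intro!: continuous_intros simp: less_imp_neq[symmetric])

lemma nonlocal_integrable:
  assumes w: "continuous_on UNIV w" and w_le: "\<And>y. \<bar>w y\<bar> \<le> B"
  shows "(\<lambda>s. w (x - s) * gam H \<zeta> s x) absolutely_integrable_on {0..}"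
proof (rule absolutely_integrable_on_quadratic_decay)
  show "continuous_on {0..} (\<lambda>s. w (x - s) * gam H \<zeta> s x)"
    by (intro continuous_intros continuous_on_compose2[OF w] continuous_on_subset[OF gam_cont(1)]) auto
  show "\<bar>w (x - s) * gam H \<zeta> s x\<bar> \<le> (B * (C * (1 + Z\<^sup>2) / \<delta>\<^sup>2)) * inverse (1 + s\<^sup>2)"
    if "0 \<le> s" for s
    using mult_mono[OF w_le gam_le[OF that] order_trans[OF abs_ge_zero w_le], of x "x - s"]
    by (auto simp: abs_mult mult.assoc)
qed

text \<open>Rescaling s = \<zeta>(x) r replaces the x-dependent kernel by the fixed
  \<open>H\<close>, leaving x in the argument of \<open>w\<close> and in one prefactor.\<close>

lemma nonlocal_eq:
  assumes w: "continuous_on UNIV w" and w_le: "\<And>y. \<bar>w y\<bar> \<le> B"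
  shows "nonlocal w x = integral {0..} (\<lambda>r. w (x - \<zeta> x * r) * H r) / \<zeta> x"
proof -
  have "nonlocal w x = \<zeta> x * integral {0..} (\<lambda>r. w (x - \<zeta> x * r) * gam H \<zeta> (\<zeta> x * r) x)"
    unfolding nonlocal_def
    by (rule integral_scale_half_line[OF nonlocal_integrable[OF assms] \<zeta>_pos])
  also have "\<dots> = \<zeta> x * integral {0..} (\<lambda>r. w (x - \<zeta> x * r) * H r / (\<zeta> x)\<^sup>2)"
    using \<zeta>_pos[of x] by (simp add: gam_eq)
  finally show ?thesis
    using \<zeta>_pos[of x] by (simp add: power2_eq_square)
qed

text \<open>The case of the constant function 1: \<open>kfun\<close> depends on x only through the
  reciprocal of \<zeta>, hence inherits its regularity.\<close>

lemma kfun_eq: "kfun H \<zeta> x = integral {0..} H / \<zeta> x"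
  using nonlocal_eq[of "\<lambda>_. 1" 1 x] by (simp add: nonlocal_def kfun_def)

lemma kfun_has_derivative:
  "(kfun H \<zeta> has_real_derivative - integral {0..} H * \<zeta>' x / (\<zeta> x)\<^sup>2) (at x)"
  unfolding kfun_eq[abs_def] using \<zeta>_pos[of x]
  by (auto intro!: derivative_eq_intros \<zeta>_deriv simp: power2_eq_square)

section \<open>Integration by parts and the spatial derivative\<close>

text \<open>A bounded derivative makes \<open>W\<close> Lipschitz; the second bound casts the
  resulting linear growth in the form \<open>1 + r\<close> that \<open>H'_decay\<close>
  absorbs.\<close>

lemma antiderivative_growth:
  assumes W: "\<And>y. (W has_real_derivative w y) (at y)" and w_le: "\<And>y. \<bar>w y\<bar> \<le> B"
  shows "\<bar>W a - W b\<bar> \<le> B * \<bar>a - b\<bar>"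
    and "0 \<le> r \<Longrightarrow> \<bar>W (x - \<zeta> x * r)\<bar> \<le> (\<bar>W x\<bar> + B * \<zeta> x) * (1 + r)"
proof -
  show lip: "\<bar>W a - W b\<bar> \<le> B * \<bar>a - b\<bar>" for a b
    using field_differentiable_bound[of UNIV W w B a b] W w_le by auto
  have B: "0 \<le> B"
    using order_trans[OF abs_ge_zero w_le[of 0]] .
  assume r: "0 \<le> r"
  have "\<bar>W (x - \<zeta> x * r)\<bar> \<le> \<bar>W x\<bar> + B * (\<zeta> x * r)"
    using lip[of "x - \<zeta> x * r" x] r \<zeta>_pos[of x] by (simp add: abs_mult)
  also have "\<dots> \<le> (\<bar>W x\<bar> + B * \<zeta> x) * (1 + r)"
    using r B \<zeta>_pos[of x] by (simp add: algebra_simps)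
  finally show "\<bar>W (x - \<zeta> x * r)\<bar> \<le> (\<bar>W x\<bar> + B * \<zeta> x) * (1 + r)" .
qed

lemma antiderivative_integrable:
  assumes W: "\<And>y. (W has_real_derivative w y) (at y)" and w_le: "\<And>y. \<bar>w y\<bar> \<le> B"
  shows "(\<lambda>r. W (x - \<zeta> x * r) * H' r) absolutely_integrable_on {0..}"
proof (rule absolutely_integrable_on_quadratic_decay)
  have W_cont: "continuous_on UNIV W"
    using W DERIV_isCont by (blast intro: continuous_at_imp_continuous_on)
  show "continuous_on {0..} (\<lambda>r. W (x - \<zeta> x * r) * H' r)"
    by (intro continuous_intros continuous_on_compose2[OF W_cont]) auto
  show "\<bar>W (x - \<zeta> x * r) * H' r\<bar> \<le> ((\<bar>W x\<bar> + B * \<zeta> x) * C) * inverse (1 + r\<^sup>2)" if "0 \<le> r" for r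
  proof -
    have A: "0 \<le> \<bar>W x\<bar> + B * \<zeta> x"
      using order_trans[OF abs_ge_zero w_le[of 0]] \<zeta>_pos[of x] by auto
    have "\<bar>W (x - \<zeta> x * r) * H' r\<bar> \<le> (\<bar>W x\<bar> + B * \<zeta> x) * (1 + r) * \<bar>H' r\<bar>"
      unfolding abs_mult by (intro mult_right_mono antiderivative_growth[OF W w_le] that) auto
    also have "\<dots> \<le> (\<bar>W x\<bar> + B * \<zeta> x) * (C * inverse (1 + r\<^sup>2))"
      using mult_left_mono[OF H'_decay[OF that] A] by (simp add: mult.assoc)
    finally show ?thesis
      by (simp add: mult.assoc)
  qed
qed

text \<open>Integrating the r-derivative of \<open>W (x - \<zeta> x * r) * H r\<close> moves the
  derivative from \<open>W\<close> to \<open>H\<close>. The right-hand side can then be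
  differentiated in x although \<open>w\<close> is merely continuous.\<close>

lemma nonlocal_by_parts:
  assumes w: "continuous_on UNIV w" and w_le: "\<And>y. \<bar>w y\<bar> \<le> B"
    and W: "\<And>y. (W has_real_derivative w y) (at y)"
  shows "(\<zeta> x)\<^sup>2 * nonlocal w x = W x * H 0 + integral {0..} (\<lambda>r. W (x - \<zeta> x * r) * H' r)"
proof -
  define A where "A = \<bar>W x\<bar> + B * \<zeta> x"
  have B: "0 \<le> B"
    using order_trans[OF abs_ge_zero w_le[of 0]] .
  have A: "0 \<le> A"
    using B \<zeta>_pos[of x] by (auto simp: A_def)
  define f where "f r = W (x - \<zeta> x * r) * H' r" for r
  define g where "g r = w (x - \<zeta> x * r) * H r" for r
  have f: "f absolutely_integrable_on {0..}"
    unfolding f_def by (rule antiderivative_integrable[OF W w_le])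
  have g: "g absolutely_integrable_on {0..}"
  proof (rule absolutely_integrable_on_quadratic_decay)
    show "continuous_on {0..} g"
      unfolding g_def by (intro continuous_intros continuous_on_compose2[OF w]) auto
    show "\<bar>g r\<bar> \<le> (B * C) * inverse (1 + r\<^sup>2)" if "0 \<le> r" for r
      using mult_mono[OF w_le H_decay[OF that] B, of "x - \<zeta> x * r"]
      by (auto simp: g_def abs_mult mult.assoc)
  qed
  have int: "(\<lambda>r. f r - \<zeta> x * g r) absolutely_integrable_on {0..}"
    by (intro set_integral_diff(1) f set_integrable_mult_right) (use g in auto)
  have "integral {0..} (\<lambda>r. f r - \<zeta> x * g r) = 0 - W (x - \<zeta> x * 0) * H 0"
  proof (rule integral_FTC_at_top[OF _ int])
    show "((\<lambda>r. W (x - \<zeta> x * r) * H r) has_real_derivative f r - \<zeta> x * g r) (at r)" for r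
      unfolding f_def g_def
      by (auto intro!: derivative_eq_intros DERIV_chain2[OF W] H_deriv)
    \<comment> \<open>The boundary term at infinity is linear growth against quadratic decay; for r
      at least 1 it is of order 1/r.\<close>
    show "((\<lambda>r. W (x - \<zeta> x * r) * H r) \<longlongrightarrow> 0) at_top"
    proof (rule Lim_null_comparison)
      show "\<forall>\<^sub>F r in at_top. norm (W (x - \<zeta> x * r) * H r) \<le> A * C * 2 * inverse r"
        using eventually_ge_at_top[of 1]
      proof eventually_elim
        case (elim r)
        have "norm (W (x - \<zeta> x * r) * H r) \<le> (A * (1 + r)) * (C * inverse (1 + r\<^sup>2))"
          unfolding real_norm_def abs_mult A_def using elim A
          by (intro mult_mono antiderivative_growth[OF W w_le] H_decay) (auto simp: A_def)
        also have "\<dots> = (A * C) * ((1 + r) * inverse (1 + r\<^sup>2))"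
          by simp
        also have "(1 + r) * inverse (1 + r\<^sup>2) \<le> (2 * r) * inverse (r\<^sup>2)"
          using elim by (intro mult_mono le_imp_inverse_le) auto
        also have "(2 * r) * inverse (r\<^sup>2) = 2 * inverse r"
          using elim by (simp add: power2_eq_square field_simps)
        finally show ?case
          using A C_nonneg by (simp add: mult_left_mono)
      qed
      show "((\<lambda>r. A * C * 2 * inverse r) \<longlongrightarrow> 0) at_top"
        by (intro tendsto_mult_right_zero tendsto_inverse_0_at_top filterlim_ident)
    qed
  qed
  moreover have "integral {0..} (\<lambda>r. f r - \<zeta> x * g r) = integral {0..} f - \<zeta> x * integral {0..} g"
    using f g by (subst integral_diff) (auto intro!: integrable_on_mult_right set_lebesgue_integral_eq_integral(1))
  moreover have "(\<zeta> x)\<^sup>2 * nonlocal w x = \<zeta> x * integral {0..} g"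
    using nonlocal_eq[OF w w_le, of x] \<zeta>_pos[of x] by (simp add: g_def[abs_def] power2_eq_square)
  ultimately show ?thesis
    by (simp add: f_def[abs_def])
qed

text \<open>The antiderivative \<open>W\<close> is differentiable with derivative \<open>w\<close>,
  so the by-parts formula can be differentiated under the integral without a derivative of
  \<open>w\<close>.\<close>

lemma nonlocal_has_derivative:
  assumes w: "continuous_on UNIV w" and w_le: "\<And>y. \<bar>w y\<bar> \<le> B"
  shows "(nonlocal w has_real_derivative nonlocal_deriv w x) (at x)"
proof -
  obtain W where W: "\<And>y. (W has_real_derivative w y) (at y)"
    using continuous_antiderivative[OF w] by blast
  have B: "0 \<le> B"
    using order_trans[OF abs_ge_zero w_le[of 0]] .
  define J where "J x = integral {0..} (\<lambda>r. W (x - \<zeta> x * r) * H' r)" for x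
  define j where "j = integral {0..} (\<lambda>r. w (x - \<zeta> x * r) * ((1 - \<zeta>' x * r) * H' r))"
  have J: "(J has_real_derivative j) (at x)"
    unfolding J_def[abs_def] j_def
  proof (rule has_real_derivative_integral_dominated)
    show "(\<lambda>r. W (x - \<zeta> x * r) * H' r) integrable_on {0..}" for x
      using antiderivative_integrable[OF W w_le] set_lebesgue_integral_eq_integral(1) by blast
    show "(\<lambda>r. B * (1 + M) * (C * inverse (1 + r\<^sup>2))) integrable_on {0..}"
      by (intro integrable_on_mult_right integrable_on_inverse_1_plus_square)
    \<comment> \<open>Since \<zeta> is M-Lipschitz, the two arguments of \<open>W\<close> differ by
      at most \<open>(1 + M) * \<bar>x - y\<bar> * (1 + r)\<close>; the factor \<open>1 + r\<close>
      is absorbed by \<open>H'_decay\<close>.\<close>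
    show "\<bar>W (x - \<zeta> x * r) * H' r - W (y - \<zeta> y * r) * H' r\<bar>
        \<le> B * (1 + M) * (C * inverse (1 + r\<^sup>2)) * \<bar>x - y\<bar>" if "r \<in> {0..}" for x y r
    proof -
      have r: "0 \<le> r"
        using that by simp
      have "\<bar>\<zeta> x - \<zeta> y\<bar> \<le> M * \<bar>x - y\<bar>"
        using field_differentiable_bound[of UNIV \<zeta> \<zeta>' M x y] \<zeta>_deriv \<zeta>'_le by auto
      then have "\<bar>(\<zeta> x - \<zeta> y) * r\<bar> \<le> M * \<bar>x - y\<bar> * r"
        using r by (simp add: abs_mult mult_right_mono)
      then have "\<bar>(x - \<zeta> x * r) - (y - \<zeta> y * r)\<bar> \<le> \<bar>x - y\<bar> + M * \<bar>x - y\<bar> * r"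
        by (simp add: algebra_simps abs_le_iff abs_if split: if_splits)
      also have "\<dots> \<le> (1 + M) * \<bar>x - y\<bar> * (1 + r)"
        using r M_nonneg by (simp add: algebra_simps)
      finally have "B * \<bar>(x - \<zeta> x * r) - (y - \<zeta> y * r)\<bar> \<le> B * ((1 + M) * \<bar>x - y\<bar> * (1 + r))"
        using B by (rule mult_left_mono)
      then have "\<bar>W (x - \<zeta> x * r) - W (y - \<zeta> y * r)\<bar> \<le> B * ((1 + M) * \<bar>x - y\<bar> * (1 + r))"
        using antiderivative_growth(1)[OF W w_le] order_trans by blast
      then have "\<bar>W (x - \<zeta> x * r) - W (y - \<zeta> y * r)\<bar> * \<bar>H' r\<bar>
          \<le> B * ((1 + M) * \<bar>x - y\<bar> * (1 + r)) * \<bar>H' r\<bar>"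
        by (rule mult_right_mono) simp
      also have "\<dots> = B * (1 + M) * \<bar>x - y\<bar> * ((1 + r) * \<bar>H' r\<bar>)"
        by simp
      also have "\<dots> \<le> B * (1 + M) * \<bar>x - y\<bar> * (C * inverse (1 + r\<^sup>2))"
        using B M_nonneg by (intro mult_left_mono H'_decay[OF r]) auto
      finally show ?thesis
        unfolding left_diff_distrib[symmetric] abs_mult by (simp only: ac_simps)
    qed
    show "((\<lambda>x. W (x - \<zeta> x * r) * H' r) has_real_derivative
        w (x - \<zeta> x * r) * ((1 - \<zeta>' x * r) * H' r)) (at x)" for r
      by (auto intro!: derivative_eq_intros DERIV_chain2[OF W] \<zeta>_deriv)
  qed
  have eq: "nonlocal w = (\<lambda>x. (W x * H 0 + J x) / (\<zeta> x)\<^sup>2)"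
  proof
    fix x
    have "W x * H 0 + J x = (\<zeta> x)\<^sup>2 * nonlocal w x"
      unfolding J_def by (rule nonlocal_by_parts[OF w w_le W, symmetric])
    then show "nonlocal w x = (W x * H 0 + J x) / (\<zeta> x)\<^sup>2"
      using \<zeta>_pos[of x] by simp
  qed
  have "((\<lambda>x. (W x * H 0 + J x) / (\<zeta> x)\<^sup>2) has_real_derivative
      ((w x * H 0 + j) * (\<zeta> x)\<^sup>2 - (W x * H 0 + J x) * (2 * \<zeta> x * \<zeta>' x)) / ((\<zeta> x)\<^sup>2 * (\<zeta> x)\<^sup>2)) (at x)"
    using \<zeta>_pos[of x]
    by (auto intro!: derivative_eq_intros W J \<zeta>_deriv)
  \<comment> \<open>The quotient rule is rearranged so that \<open>W\<close> survives only in the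
    quotient equal to \<open>nonlocal w x\<close>.\<close>
  also have "((w x * H 0 + j) * (\<zeta> x)\<^sup>2 - (W x * H 0 + J x) * (2 * \<zeta> x * \<zeta>' x)) / ((\<zeta> x)\<^sup>2 * (\<zeta> x)\<^sup>2)
      = (w x * H 0 + j) / (\<zeta> x)\<^sup>2 - 2 * \<zeta>' x / \<zeta> x * ((W x * H 0 + J x) / (\<zeta> x)\<^sup>2)"
    using \<zeta>_pos[of x] by (simp add: power2_eq_square divide_simps) (simp add: algebra_simps)
  finally show ?thesis
    unfolding nonlocal_deriv_def j_def[symmetric] by (simp add: eq)
qed

section \<open>Joint continuity in space and time\<close>

text \<open>Continuity of \<open>w\<close> is asked in time alone, so this applies to the solution
  before its spatial continuity is known.\<close>

lemma continuous_on_nonlocal: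
  fixes w :: "real \<Rightarrow> real \<Rightarrow> real"
  assumes "\<And>y. continuous_on I (w y)" and "\<And>y t. t \<in> I \<Longrightarrow> \<bar>w y t\<bar> \<le> B"
    and "\<And>x t. t \<in> I \<Longrightarrow> (\<lambda>s. w (x - s) t * gam H \<zeta> s x) integrable_on {0..}"
  shows "continuous_on (UNIV \<times> I) (\<lambda>(x, t). nonlocal (\<lambda>y. w y t) x)"
  unfolding nonlocal_def
  by (rule continuous_on_nonlocal_integral[where \<Phi> = "gam H \<zeta>", OF gam_cont(2) gam_le assms])

text \<open>After rescaling, x enters the argument of \<open>w\<close>, so joint continuity of
  \<open>w\<close> is what gives pointwise convergence of the integrand; the decay of
  \<open>H'\<close> gives the majorant.\<close>

lemma continuous_on_nonlocal_deriv:
  fixes w :: "real \<Rightarrow> real \<Rightarrow> real"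
  assumes w: "continuous_on (UNIV \<times> I) (\<lambda>(y, t). w y t)"
    and w_le: "\<And>y t. t \<in> I \<Longrightarrow> \<bar>w y t\<bar> \<le> B"
  shows "continuous_on (UNIV \<times> I) (\<lambda>(x, t). nonlocal_deriv (\<lambda>y. w y t) x)"
proof (cases "I = {}")
  case False
  then have B: "0 \<le> B"
    using order_trans[OF abs_ge_zero w_le] by blast
  note w_comp = continuous_on_compose_pair[OF w]
  have w_t: "continuous_on UNIV (\<lambda>y. w y t)" if "t \<in> I" for t
    using that by (intro w_comp continuous_intros) auto
  have N: "continuous_on (UNIV \<times> I) (\<lambda>p. nonlocal (\<lambda>y. w y (snd p)) (fst p))"
  proof -
    have "continuous_on (UNIV \<times> I) (\<lambda>(x, t). nonlocal (\<lambda>y. w y t) x)"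
    proof (rule continuous_on_nonlocal[OF _ w_le])
      show "continuous_on I (w y)" for y
        by (intro w_comp continuous_intros) auto
      show "(\<lambda>s. w (x - s) t * gam H \<zeta> s x) integrable_on {0..}" if "t \<in> I" for x t
        using nonlocal_integrable[OF w_t[OF that] w_le[OF that]]
          set_lebesgue_integral_eq_integral(1) by blast
    qed
    then show ?thesis
      by (simp add: case_prod_beta)
  qed
  have le: "\<bar>w (x - \<zeta> x * r) t * ((1 - \<zeta>' x * r) * H' r)\<bar> \<le> B * (1 + M) * C * inverse (1 + r\<^sup>2)"
    if "t \<in> I" "0 \<le> r" for x t r
  proof -
    have "\<bar>\<zeta>' x * r\<bar> \<le> M * r"
      using that(2) \<zeta>'_le[of x] by (simp add: abs_mult mult_right_mono)
    then have "\<bar>1 - \<zeta>' x * r\<bar> \<le> 1 + M * r"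
      by linarith
    also have "\<dots> \<le> (1 + M) * (1 + r)"
      using that(2) M_nonneg by (simp add: algebra_simps)
    finally have "\<bar>1 - \<zeta>' x * r\<bar> * \<bar>H' r\<bar> \<le> (1 + M) * (1 + r) * \<bar>H' r\<bar>"
      by (rule mult_right_mono) simp
    also have "\<dots> \<le> (1 + M) * (C * inverse (1 + r\<^sup>2))"
      using mult_left_mono[OF H'_decay[OF that(2)], of "1 + M"] M_nonneg by (simp add: mult.assoc)
    finally have "\<bar>w (x - \<zeta> x * r) t\<bar> * (\<bar>1 - \<zeta>' x * r\<bar> * \<bar>H' r\<bar>)
        \<le> B * ((1 + M) * (C * inverse (1 + r\<^sup>2)))"
      using w_le[OF that(1)] B by (rule_tac mult_mono) auto
    then show ?thesis
      by (simp add: abs_mult mult.assoc)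
  qed
  have "continuous_on (UNIV \<times> I) (\<lambda>p. integral {0..}
      (\<lambda>r. w (fst p - \<zeta> (fst p) * r) (snd p) * ((1 - \<zeta>' (fst p) * r) * H' r)))"
  proof (rule continuous_on_integral_dominated)
    show "(\<lambda>r. w (fst p - \<zeta> (fst p) * r) (snd p) * ((1 - \<zeta>' (fst p) * r) * H' r)) integrable_on {0..}"
      if "p \<in> UNIV \<times> I" for p :: "real \<times> real"
    proof (rule integrable_on_quadratic_decay)
      show "continuous_on {0..} (\<lambda>r. w (fst p - \<zeta> (fst p) * r) (snd p) * ((1 - \<zeta>' (fst p) * r) * H' r))"
        using that by (intro continuous_intros w_comp) auto
    qed (use that le in auto)
    show "(\<lambda>r. B * (1 + M) * C * inverse (1 + r\<^sup>2)) integrable_on {0..}"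
      by (intro integrable_on_mult_right integrable_on_inverse_1_plus_square)
    show "continuous_on (UNIV \<times> I)
        (\<lambda>p. w (fst p - \<zeta> (fst p) * r) (snd p) * ((1 - \<zeta>' (fst p) * r) * H' r))" for r
      by (intro continuous_intros w_comp) auto
  qed (use le in auto)
  then have "continuous_on (UNIV \<times> I) (\<lambda>p. nonlocal_deriv (\<lambda>y. w y (snd p)) (fst p))"
    unfolding nonlocal_deriv_def using \<zeta>_pos
    by (intro continuous_intros w_comp N) (auto simp: less_imp_neq[symmetric])
  then show ?thesis
    by (simp add: case_prod_beta)
qed simp

end

section \<open>Variation of constants and the gain of regularity\<close>

text \<open>\<open>Q\<close> is the Duhamel integral up to time T. The representation is used twice:
  first to obtain joint continuity of \<open>u\<close>, then, with the source now differentiable in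
  x, to differentiate \<open>Q\<close>.\<close>

lemma (in upwind_kernel) solution_eq_C1_perturbation:
  fixes u :: "real \<Rightarrow> real \<Rightarrow> real"
  assumes T: "0 < T" and init: "continuous_on UNIV (\<lambda>x. u x 0)"
    and u_le: "\<And>x t. t \<in> {0..T} \<Longrightarrow> \<bar>u x t\<bar> \<le> B"
    and u_cont: "\<And>x. continuous_on {0..T} (u x)"
    and u_int: "\<And>x t. t \<in> {0..T} \<Longrightarrow>
      (\<lambda>s. (u x t - u (x - s) t) * gam H \<zeta> s x) integrable_on {0..}"
    and u_eq: "\<And>x t. t \<in> {0<..<T} \<Longrightarrow> (u x has_real_derivative
      - integral {0..} (\<lambda>s. (u x t - u (x - s) t) * gam H \<zeta> s x)) (at t)"
  shows "\<exists>Q Q'. (\<forall>x. u x T = exp (- kfun H \<zeta> x * T) * (u x 0 + Q x)) \<and>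
    (\<forall>x. (Q has_real_derivative Q' x) (at x)) \<and> continuous_on UNIV Q'"
proof -
  define k where "k = kfun H \<zeta>"
  define k' where "k' x = - integral {0..} H * \<zeta>' x / (\<zeta> x)\<^sup>2" for x
  define g where "g x t = nonlocal (\<lambda>y. u y t) x" for x t
  define g' where "g' x t = nonlocal_deriv (\<lambda>y. u y t) x" for x t
  define F where "F x \<tau> \<sigma> = \<tau> * (exp (k x * (\<tau> * \<sigma>)) * g x (\<tau> * \<sigma>))" for x \<tau> \<sigma>
  have k_deriv: "(k has_real_derivative k' x) (at x)" for x
    unfolding k_def k'_def by (rule kfun_has_derivative)
  then have k_cont: "continuous_on UNIV k"
    using DERIV_isCont by (blast intro: continuous_at_imp_continuous_on)
  have k'_cont: "continuous_on UNIV k'"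
    unfolding k'_def using \<zeta>_pos by (intro continuous_intros) (auto simp: less_imp_neq[symmetric])
  note [continuous_intros] =
    continuous_on_compose2[OF k_cont _ subset_UNIV] continuous_on_compose2[OF k'_cont _ subset_UNIV]
  have gam_int: "(\<lambda>s. gam H \<zeta> s x) integrable_on {0..}" for x
    using nonlocal_integrable[of "\<lambda>_. 1" 1 x] set_lebesgue_integral_eq_integral(1) by auto
  \<comment> \<open>Both \<open>u x t * gam H \<zeta> s x\<close> and the integrand of the equation
    are integrable in s; their difference is the retarded part.\<close>
  have int: "(\<lambda>s. u (x - s) t * gam H \<zeta> s x) integrable_on {0..}" if "t \<in> {0..T}" for x t
    using integrable_diff[OF integrable_on_mult_right[OF gam_int, of "u x t" x] u_int[OF that, of x]]
    by (simp add: algebra_simps)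
  have integral_eq: "integral {0..} (\<lambda>s. (u x t - u (x - s) t) * gam H \<zeta> s x) = u x t * k x - g x t"
    if "t \<in> {0..T}" for x t
    using integral_diff[OF integrable_on_mult_right[OF gam_int, of "u x t" x] int[OF that, of x]]
    by (simp add: left_diff_distrib g_def nonlocal_def k_def kfun_def)
  have u_deriv: "(u x has_real_derivative g x t - k x * u x t) (at t)" if "t \<in> {0<..<T}" for x t
    using u_eq[OF that, of x] integral_eq[of t x] that by (simp add: mult.commute)
  have g_cont: "continuous_on (UNIV \<times> {0..T}) (\<lambda>(x, t). g x t)"
    unfolding g_def by (rule continuous_on_nonlocal[OF u_cont u_le int])
  note g_comp = continuous_on_compose_pair[OF g_cont]
  have scale: "\<tau> * \<sigma> \<in> {0..T}" if "\<tau> \<in> {0..T}" "\<sigma> \<in> {0..1}" for \<tau> \<sigma>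
    using that mult_mono[of \<tau> T \<sigma> 1] T by auto
  \<comment> \<open>Variation of constants, over the fixed interval [0,1] so that the integral is a continuous
    function of the time as well.\<close>
  have F_int: "(F x \<tau> has_integral exp (k x * \<tau>) * u x \<tau> - u x 0) {0..1}" if \<tau>: "\<tau> \<in> {0..T}" for x \<tau>
  \<comment> \<open>For \<tau> = 0 the points \<tau> * \<sigma> never enter the open time interval
    where the equation holds; there both sides vanish.\<close>
  proof (cases "\<tau> = 0")
    case False
    have "(F x \<tau> has_integral exp (k x * (\<tau> * 1)) * u x (\<tau> * 1) - exp (k x * (\<tau> * 0)) * u x (\<tau> * 0)) {0..1}"
    \<comment> \<open>The equation is available only at interior times; the endpoints are reached by
      continuity in time.\<close>
    proof (rule fundamental_theorem_of_calculus_interior)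
      show "continuous_on {0..1} (\<lambda>\<sigma>. exp (k x * (\<tau> * \<sigma>)) * u x (\<tau> * \<sigma>))"
        using scale[OF \<tau>] by (intro continuous_intros continuous_on_compose2[OF u_cont]) auto
      show "((\<lambda>\<sigma>. exp (k x * (\<tau> * \<sigma>)) * u x (\<tau> * \<sigma>)) has_vector_derivative F x \<tau> \<sigma>) (at \<sigma>)"
        if "\<sigma> \<in> {0<..<1}" for \<sigma>
      proof -
        have "0 < \<tau> * \<sigma>" "\<tau> * \<sigma> < \<tau>" "\<tau> \<le> T"
          using that False \<tau> by auto
        then have "\<tau> * \<sigma> \<in> {0<..<T}"
          unfolding greaterThanLessThan_iff by linarith
        from u_deriv[OF this, of x]
        have u\<sigma>: "((\<lambda>\<sigma>. u x (\<tau> * \<sigma>)) has_real_derivative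
            (g x (\<tau> * \<sigma>) - k x * u x (\<tau> * \<sigma>)) * \<tau>) (at \<sigma>)"
          by (rule DERIV_chain2) (auto intro!: derivative_eq_intros)
        have "((\<lambda>\<sigma>. exp (k x * (\<tau> * \<sigma>))) has_real_derivative
            exp (k x * (\<tau> * \<sigma>)) * (k x * \<tau>)) (at \<sigma>)"
          by (auto intro!: derivative_eq_intros)
        from DERIV_mult[OF this u\<sigma>]
        have "((\<lambda>\<sigma>. exp (k x * (\<tau> * \<sigma>)) * u x (\<tau> * \<sigma>)) has_real_derivative F x \<tau> \<sigma>) (at \<sigma>)"
          unfolding F_def by (rule DERIV_cong) (simp add: algebra_simps)
        then show ?thesis
          by (simp add: has_real_derivative_iff_has_vector_derivative)
      qed
    qed simp
    then show ?thesis by simp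
  qed (simp add: F_def[abs_def])
  have u_rep: "u x \<tau> = exp (- k x * \<tau>) * (u x 0 + integral {0..1} (F x \<tau>))" if "\<tau> \<in> {0..T}" for x \<tau>
    using integral_unique[OF F_int[OF that, of x]] by (simp add: exp_minus)
  have "continuous_on (UNIV \<times> {0..T}) (\<lambda>p. integral (cbox 0 1) (F (fst p) (snd p)))"
  proof (rule integral_continuous_on_param)
    show "continuous_on ((UNIV \<times> {0..T}) \<times> cbox 0 1) (\<lambda>(p, \<sigma>). F (fst p) (snd p) \<sigma>)"
      unfolding F_def case_prod_beta using scale
      by (intro continuous_intros g_comp) auto
  qed
  \<comment> \<open>Spatial continuity of \<open>u\<close> comes from the initial datum plus the
    Duhamel term, whose integrand is already jointly continuous.\<close>
  then have "continuous_on (UNIV \<times> {0..T})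
      (\<lambda>p. exp (- k (fst p) * snd p) * (u (fst p) 0 + integral {0..1} (F (fst p) (snd p))))"
    by (intro continuous_intros continuous_on_compose2[OF init]) auto
  then have u_joint: "continuous_on (UNIV \<times> {0..T}) (\<lambda>(x, t). u x t)"
  proof (rule continuous_on_eq)
    fix p :: "real \<times> real" assume "p \<in> UNIV \<times> {0..T}"
    then show "exp (- k (fst p) * snd p) * (u (fst p) 0 + integral {0..1} (F (fst p) (snd p)))
        = (case p of (x, t) \<Rightarrow> u x t)"
      unfolding case_prod_beta by (intro u_rep[symmetric]) (simp add: mem_Times_iff)
  qed
  then have g'_cont: "continuous_on (UNIV \<times> {0..T}) (\<lambda>(x, t). g' x t)"
    unfolding g'_def by (rule continuous_on_nonlocal_deriv[OF _ u_le])
  have g_deriv: "((\<lambda>x. g x t) has_real_derivative g' x t) (at x)" if "t \<in> {0..T}" for x t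
  proof -
    have "continuous_on UNIV (\<lambda>y. u y t)"
      using that by (intro continuous_on_compose_pair[OF u_joint] continuous_intros) auto
    then show ?thesis
      unfolding g_def g'_def using nonlocal_has_derivative u_le[OF that] by blast
  qed
  \<comment> \<open>The x-derivative of \<open>F x T \<sigma>\<close>, with x entering both the
    exponential rate and the source.\<close>
  define F' where "F' x \<sigma> = T * (exp (k x * (T * \<sigma>)) * (k' x * (T * \<sigma>)) * g x (T * \<sigma>)
      + exp (k x * (T * \<sigma>)) * g' x (T * \<sigma>))" for x \<sigma>
  have T_scale: "T * \<sigma> \<in> {0..T}" if "\<sigma> \<in> {0..1}" for \<sigma>
    using scale[of T \<sigma>] that T by auto
  have F'_cont: "continuous_on (UNIV \<times> cbox 0 1) (\<lambda>(x, \<sigma>). F' x \<sigma>)"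
    unfolding F'_def case_prod_beta using T_scale
    by (intro continuous_intros g_comp continuous_on_compose_pair[OF g'_cont]) auto
  \<comment> \<open>The time domain is compact, so joint continuity of \<open>F'\<close> suffices
    here; no majorant has to be supplied.\<close>
  have "((\<lambda>x. integral (cbox 0 1) (F x T)) has_real_derivative integral (cbox 0 1) (F' x)) (at x)" for x
  proof (rule leibniz_rule_field_derivative[where U = UNIV, OF _ _ F'_cont])
    show "((\<lambda>x. F x T \<sigma>) has_real_derivative F' x \<sigma>) (at x)" if "\<sigma> \<in> cbox 0 1" for x \<sigma>
      unfolding F_def F'_def using that T_scale[of \<sigma>]
      by (auto intro!: derivative_eq_intros k_deriv g_deriv)
    show "F x T integrable_on cbox 0 1" for x
      using F_int[of T x] T by auto
  qed auto
  moreover have "continuous_on UNIV (\<lambda>x. integral (cbox 0 1) (F' x))"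
    by (rule integral_continuous_on_param[OF F'_cont])
  moreover have "u x T = exp (- k x * T) * (u x 0 + integral (cbox 0 1) (F x T))" for x
    using u_rep[of T x] T by simp
  ultimately show ?thesis
    unfolding k_def
    by (intro exI[of _ "\<lambda>x. integral (cbox 0 1) (F x T)"]
        exI[of _ "\<lambda>x. integral (cbox 0 1) (F' x)"] conjI allI)
qed

section \<open>From the regularity result to jumps\<close>

lemma smooth_fun_C1:
  assumes "smooth_fun f"
  shows "(f has_real_derivative deriv f x) (at x)" "continuous_on UNIV (deriv f)"
proof -
  show "(f has_real_derivative deriv f x) (at x)"
    using assms[unfolded smooth_fun_def, rule_format, of 0 x]
    by (simp add: DERIV_deriv_iff_real_differentiable)
  show "continuous_on UNIV (deriv f)"
    using assms[unfolded smooth_fun_def, rule_format, of 1]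
    by (auto intro!: continuous_at_imp_continuous_on differentiable_imp_continuous_within)
qed

text \<open>Expanding \<open>(1 + s\<^sup>2) * (1 + s)\<close> shows which moments are needed:
  weights of degree 0 and 2 for \<open>H\<close>, degrees 0 to 3 for its derivative. The minimum of
  \<zeta> serves as \<delta>.\<close>

lemma upwind_kernel_smooth:
  assumes H: "smooth_fun H" and \<zeta>: "smooth_fun \<zeta>"
    and decay: "\<forall>n m. \<exists>C. \<forall>s. \<bar>s\<bar> ^ m * \<bar>(deriv ^^ n) H s\<bar> \<le> C"
    and Z: "\<exists>B. \<forall>x. \<bar>\<zeta> x\<bar> \<le> B" and M: "\<exists>B. \<forall>x. \<bar>deriv \<zeta> x\<bar> \<le> B"
    and \<delta>: "\<exists>x0. \<zeta> x0 > 0 \<and> (\<forall>x. \<zeta> x0 \<le> \<zeta> x)"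
  shows "\<exists>\<delta> Z M C. upwind_kernel H (deriv H) \<zeta> (deriv \<zeta>) \<delta> Z M C"
proof -
  obtain c where c: "\<And>n m s. \<bar>s\<bar> ^ m * \<bar>(deriv ^^ n) H s\<bar> \<le> c n m"
    using decay by metis
  have H_le: "(1 + s\<^sup>2) * \<bar>H s\<bar> \<le> c 0 0 + c 0 2" for s
    using c[of s 0 0] c[of s 2 0] by (simp add: algebra_simps)
  have H'_le: "(1 + s\<^sup>2) * ((1 + s) * \<bar>deriv H s\<bar>) \<le> c 1 0 + c 1 1 + c 1 2 + c 1 3" if "0 \<le> s" for s
    using c[of s 0 1] c[of s 1 1] c[of s 2 1] c[of s 3 1] that
    by (simp add: algebra_simps power2_eq_square power3_eq_cube)
  define C where "C = max (c 0 0 + c 0 2) (c 1 0 + c 1 1 + c 1 2 + c 1 3)"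
  have pos: "0 < 1 + s\<^sup>2" for s :: real
    by (simp add: add_pos_nonneg)
  have divide: "a \<le> C * inverse (1 + s\<^sup>2)" if "(1 + s\<^sup>2) * a \<le> C" for a s :: real
    using that pos[of s] by (simp add: field_simps)
  obtain Z M x0 where Z: "\<And>x. \<bar>\<zeta> x\<bar> \<le> Z" and M: "\<And>x. \<bar>deriv \<zeta> x\<bar> \<le> M"
    and x0: "0 < \<zeta> x0" "\<And>x. \<zeta> x0 \<le> \<zeta> x"
    using Z M \<delta> by blast
  have "upwind_kernel H (deriv H) \<zeta> (deriv \<zeta>) (\<zeta> x0) Z M C"
  proof
    show "\<bar>H s\<bar> \<le> C * inverse (1 + s\<^sup>2)" for s
      using H_le[of s] by (intro divide) (simp add: C_def)
    show "(1 + s) * \<bar>deriv H s\<bar> \<le> C * inverse (1 + s\<^sup>2)" if "0 \<le> s" for s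
      using H'_le[OF that] by (intro divide) (simp add: C_def)
    show "\<zeta> x \<le> Z" for x
      using Z[of x] by simp
  qed (use smooth_fun_C1[OF H] smooth_fun_C1[OF \<zeta>] M x0 in auto)
  then show ?thesis
    by blast
qed

text \<open>The continuous term \<open>a\<close> has equal one-sided limits and cancels, while
  \<open>b\<close> factors out with its value at x. One-sided limits depend only on a punctured
  neighbourhood, so equality near x suffices.\<close>

lemma has_jump_affine:
  assumes f: "\<forall>\<^sub>F y in at x. f y = a y + b y * p y"
    and a: "isCont a x" and b: "isCont b x" and p: "has_jump p x J"
  shows "has_jump f x (b x * J)"
proof -
  obtain l r where lr: "(p \<longlongrightarrow> r) (at_right x)" "(p \<longlongrightarrow> l) (at_left x)" "J = r - l"
    using p unfolding has_jump_def by blast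
  have lim: "(f \<longlongrightarrow> a x + b x * c) (at x within S)" if "(p \<longlongrightarrow> c) (at x within S)" for c S
  proof (rule Lim_transform_eventually)
    have "(a \<longlongrightarrow> a x) (at x within S)" "(b \<longlongrightarrow> b x) (at x within S)"
      using a b by (auto simp: isCont_def intro: tendsto_within_subset)
    then show "((\<lambda>y. a y + b y * p y) \<longlongrightarrow> a x + b x * c) (at x within S)"
      using that by (intro tendsto_intros)
    show "\<forall>\<^sub>F y in at x within S. a y + b y * p y = f y"
      using filter_leD[OF at_le[OF subset_UNIV] f, of S] by (rule eventually_mono) simp
  qed
  have "b x * J = (a x + b x * r) - (a x + b x * l)"
    by (simp add: lr(3) algebra_simps)
  then show ?thesis
    unfolding has_jump_def using lim[OF lr(1)] lim[OF lr(2)] by blast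
qed

text \<open>\<open>has_jump\<close> reads values on a punctured neighbourhood; the differentiability
  clause makes \<open>deriv\<close> of the solution a genuine derivative there. One witness
  \<open>J0\<close> is shared by all three jumps.\<close>

theorem theorem2:
  fixes H \<zeta> \<psi>0 :: "real \<Rightarrow> real" and u :: "real \<Rightarrow> real \<Rightarrow> real" and S :: "real set"
  assumes H_smooth: "smooth_fun H"
    and H_bounded: "\<exists>B. \<forall>s. \<bar>H s\<bar> \<le> B"
    and H_even: "\<forall>s. H (- s) = H s"
    and H_nonneg: "\<forall>s. H s \<ge> 0"
    and H_moment: "((\<lambda>s. s * H s) has_integral 1) {0..}"
    and H_decay: "\<forall>n m. \<exists>C. \<forall>s. \<bar>s\<bar> ^ m * \<bar>(deriv ^^ n) H s\<bar> \<le> C"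
    and \<zeta>_bounded: "\<exists>B. \<forall>x. \<bar>\<zeta> x\<bar> \<le> B"
    and \<zeta>_smooth: "smooth_fun \<zeta>"
    and \<zeta>_deriv_bounded: "\<exists>B. \<forall>x. \<bar>deriv \<zeta> x\<bar> \<le> B"
    and \<zeta>_min: "\<exists>x0. \<zeta> x0 > 0 \<and> (\<forall>x. \<zeta> x0 \<le> \<zeta> x)"
    and \<psi>0_cont: "continuous_on UNIV \<psi>0"
    and \<psi>0_bounded: "\<exists>B. \<forall>x. \<bar>\<psi>0 x\<bar> \<le> B"
    and S_finite: "finite S"
    and \<psi>0_pw_smooth: "\<forall>n x. x \<notin> S \<longrightarrow> ((deriv ^^ n) \<psi>0) differentiable (at x)"
    and \<psi>0_deriv_bounded: "\<exists>B. \<forall>x. x \<notin> S \<longrightarrow> \<bar>deriv \<psi>0 x\<bar> \<le> B"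
    and \<psi>0_deriv_jumps: "\<forall>x\<in>S. \<exists>J. has_jump (deriv \<psi>0) x J"
    and u_init: "\<forall>x. u x 0 = \<psi>0 x"
    and u_bounded: "\<forall>T. \<exists>B. \<forall>x t. 0 \<le> t \<and> t \<le> T \<longrightarrow> \<bar>u x t\<bar> \<le> B"
    and u_cont: "\<forall>x. continuous_on {0..} (\<lambda>t. u x t)"
    and u_integrable: "\<forall>x t. t \<ge> 0 \<longrightarrow>
           (\<lambda>s. (u x t - u (x - s) t) * gam H \<zeta> s x) integrable_on {0..}"
    and u_eq: "\<forall>x t. t > 0 \<longrightarrow>
           ((\<lambda>\<tau>. u x \<tau>) has_real_derivative
              - integral {0..} (\<lambda>s. (u x t - u (x - s) t) * gam H \<zeta> s x)) (at t)"
  shows "\<forall>t>0. \<forall>x.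
           (\<forall>\<^sub>F y in at x. (\<lambda>z. u z t) differentiable (at y)) \<and>
           (\<exists>J0. has_jump (deriv \<psi>0) x J0 \<and>
                 has_jump (deriv (\<lambda>z. u z 0)) x J0 \<and>
                 has_jump (deriv (\<lambda>z. u z t)) x (exp (- kfun H \<zeta> x * t) * J0))"
proof (intro allI impI)
  fix t x :: real assume t: "0 < t"
  obtain \<delta> Z M C where "upwind_kernel H (deriv H) \<zeta> (deriv \<zeta>) \<delta> Z M C"
    using upwind_kernel_smooth[OF H_smooth \<zeta>_smooth H_decay \<zeta>_bounded \<zeta>_deriv_bounded \<zeta>_min] by blast
  then interpret upwind_kernel H "deriv H" \<zeta> "deriv \<zeta>" \<delta> Z M C .
  obtain B where B: "\<And>x \<tau>. \<tau> \<in> {0..t} \<Longrightarrow> \<bar>u x \<tau>\<bar> \<le> B"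
    using u_bounded by (metis atLeastAtMost_iff)
  have "continuous_on UNIV (\<lambda>x. u x 0)"
    using \<psi>0_cont u_init by simp
  moreover have "continuous_on {0..t} (u x)" for x
    using u_cont by (rule_tac continuous_on_subset[of "{0..}"]) auto
  \<comment> \<open>The observation time itself is taken as T; the equation beyond it is not
    involved.\<close>
  ultimately have "\<exists>Q Q'. (\<forall>x. u x t = exp (- kfun H \<zeta> x * t) * (u x 0 + Q x)) \<and>
      (\<forall>x. (Q has_real_derivative Q' x) (at x)) \<and> continuous_on UNIV Q'"
    using u_integrable u_eq by (intro solution_eq_C1_perturbation[OF t _ B]) auto
  then obtain Q Q' where u_rep: "\<And>x. u x t = exp (- kfun H \<zeta> x * t) * (\<psi>0 x + Q x)"
    and Q: "\<And>x. (Q has_real_derivative Q' x) (at x)" and Q': "continuous_on UNIV Q'"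
    using u_init by auto
  define E where "E x = exp (- kfun H \<zeta> x * t)" for x
  define E' where "E' x = E x * (integral {0..} H * deriv \<zeta> x / (\<zeta> x)\<^sup>2 * t)" for x
  have E: "(E has_real_derivative E' y) (at y)" for y
    unfolding E_def[abs_def] E'_def
    by (auto intro!: derivative_eq_intros kfun_has_derivative)
  have E_cont: "continuous_on UNIV E" and Q_cont: "continuous_on UNIV Q"
    using E Q DERIV_isCont by (blast intro: continuous_at_imp_continuous_on)+
  have E'_cont: "continuous_on UNIV E'"
    unfolding E'_def using \<zeta>_pos E_cont by (intro continuous_intros) (auto simp: less_imp_neq[symmetric])
  \<comment> \<open>The product rule is grouped so that \<open>E y * deriv \<psi>0 y\<close> stands
    apart as the only term that may jump.\<close>
  have deriv: "((\<lambda>z. u z t) has_real_derivative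
      (E' y * (\<psi>0 y + Q y) + E y * Q' y) + E y * deriv \<psi>0 y) (at y)" if "y \<notin> S" for y
  proof -
    have "(\<psi>0 has_real_derivative deriv \<psi>0 y) (at y)"
      using \<psi>0_pw_smooth[rule_format, OF that, of 0] by (simp add: DERIV_deriv_iff_real_differentiable)
    then show ?thesis
      unfolding u_rep E_def[symmetric]
      by (auto intro!: derivative_eq_intros E Q simp: algebra_simps)
  qed
  \<comment> \<open>A finite set has no limit points, so a punctured neighbourhood avoids
    \<open>S\<close> even when x belongs to it.\<close>
  have ev: "\<forall>\<^sub>F y in at x. y \<notin> S"
    using islimpt_finite[OF S_finite, of x] by (auto simp: islimpt_iff_eventually)
  \<comment> \<open>Off \<open>S\<close> the second derivative exists, so
    \<open>deriv \<psi>0\<close> is continuous at x and the jump is 0; on \<open>S\<close> a jump is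
    given.\<close>
  obtain J0 where J0: "has_jump (deriv \<psi>0) x J0"
  proof (cases "x \<in> S")
    case False
    then have "isCont (deriv \<psi>0) x"
      using \<psi>0_pw_smooth[rule_format, of x 1]
      by (auto intro: differentiable_imp_continuous_within)
    then have "has_jump (deriv \<psi>0) x 0"
      unfolding has_jump_def isCont_def
      by (intro exI[of _ "deriv \<psi>0 x"]) (auto intro: tendsto_within_subset)
    then show ?thesis
      using that by blast
  qed (use that \<psi>0_deriv_jumps in blast)
  have "has_jump (deriv (\<lambda>z. u z t)) x (E x * J0)"
  proof (rule has_jump_affine[OF _ _ _ J0])
    show "\<forall>\<^sub>F y in at x. deriv (\<lambda>z. u z t) y
        = (E' y * (\<psi>0 y + Q y) + E y * Q' y) + E y * deriv \<psi>0 y"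
      using ev by eventually_elim (rule DERIV_imp_deriv[OF deriv])
    have "continuous_on UNIV (\<lambda>y. E' y * (\<psi>0 y + Q y) + E y * Q' y)"
      by (intro continuous_intros E'_cont \<psi>0_cont Q_cont E_cont Q')
    then show "isCont (\<lambda>y. E' y * (\<psi>0 y + Q y) + E y * Q' y) x"
      by (simp add: continuous_on_eq_continuous_at)
    show "isCont E x"
      using E DERIV_isCont by blast
  qed
  moreover have "\<forall>\<^sub>F y in at x. (\<lambda>z. u z t) differentiable (at y)"
    using ev by eventually_elim (use deriv real_differentiable_def in blast)
  moreover have "(\<lambda>z. u z 0) = \<psi>0"
    using u_init by auto
  ultimately show "(\<forall>\<^sub>F y in at x. (\<lambda>z. u z t) differentiable (at y)) \<and>
      (\<exists>J0. has_jump (deriv \<psi>0) x J0 \<and>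
            has_jump (deriv (\<lambda>z. u z 0)) x J0 \<and>
            has_jump (deriv (\<lambda>z. u z t)) x (exp (- kfun H \<zeta> x * t) * J0))"
    using J0 by (auto simp: E_def)
qed

end
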